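(* The following hold. (i) If $\mathcal{K}^1\subseteq\mathcal{E}^1$ and $\mathcal{K}^2\subseteq\mathcal{E}^2$ are pointed closed convex cones that are amenable, then $\mathcal{K}^1\times\mathcal{K}^2\subseteq\mathcal{E}^1\times\mathcal{E}^2$ is amenable. (ii) If $\mathcal{K}\subseteq\mathcal{E}$ is a pointed closed convex cone that is amenable and $\mathcal{A}:\mathcal{E}\to\mathcal{E}'$ is an injective linear map, then $\mathcal{A}(\mathcal{K})$ is amenable.
   Context: $\mathcal{E},\mathcal{E}',\mathcal{E}^1,\mathcal{E}^2$ are finite-dimensional real inner product spaces; $\mathcal{E}^1\times\mathcal{E}^2$ carries the inner product $\langle(x_1,x_2),(y_1,y_2)\rangle=\langle x_1,y_1\rangle+\langle x_2,y_2\rangle$. Norms are induced by the inner products and $\operatorname{dist}(x,C)=\inf\{\|x-y\|: y\in C\}$. A convex cone is a nonempty set closed under nonnegative linear combinations; it is pointed if $\mathcal{K}\cap-\mathcal{K}=\{0\}$. A face of $\mathcal{K}$ is a convex cone $\mathcal{F}\subseteq\mathcal{K}$ such that $x,y\in\mathcal{K}$, $x+y\in\mathcal{F}$ imply $x,y\in\mathcal{F}$. A closed convex cone $\mathcal{K}$ is amenable if for every face $\mathcal{F}$ of $\mathcal{K}$ there is $\kappa>0$ such that $\operatorname{dist}(x,\mathcal{F})\le\kappa\operatorname{dist}(x,\mathcal{K})$ for all $x\in\operatorname{span}\mathcal{F}$. *)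

theory Defs
  imports "HOL-Analysis.Analysis"
begin

(* Used with the class real_inner instead of the class euclidean_space, because the
   latter excludes the zero-dimensional space. *)
definition fin_dim :: "'a::real_vector itself \<Rightarrow> bool" where
  "fin_dim _ \<longleftrightarrow> (\<exists>B :: 'a set. finite B \<and> span B = UNIV)"

definition pointed :: "'a::real_vector set \<Rightarrow> bool" where
  "pointed K \<longleftrightarrow> K \<inter> uminus ` K = {0}"

(* Unlike for face_of, the empty set is not a face here: convex_cone includes nonemptiness. *)
definition cone_face :: "'a::real_vector set \<Rightarrow> 'a set \<Rightarrow> bool" where
  "cone_face F K \<longleftrightarrow>
     convex_cone F \<and> F \<subseteq> K \<and> (\<forall>x\<in>K. \<forall>y\<in>K. x + y \<in> F \<longrightarrow> x \<in> F \<and> y \<in> F)"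

definition amenable :: "'a::real_inner set \<Rightarrow> bool" where
  "amenable K \<longleftrightarrow> closed K \<and> convex_cone K \<and>
     (\<forall>F. cone_face F K \<longrightarrow>
        (\<exists>\<kappa>>0. \<forall>x\<in>span F. infdist x F \<le> \<kappa> * infdist x K))"

end

theory Submission
  imports Defs
begin

text \<open>
  (i) A face of \<open>K1 \<times> K2\<close> is the product of its two projections, which are faces of \<open>K1\<close> and
  \<open>K2\<close>: from \<open>(x, y) = (x, 0) + (0, y)\<close> both summands lie in the face. The distance to a product
  is at most the sum of the distances to the factors, and projections do not increase distances.
  (ii) An injective linear map on a finite-dimensional space is bi-Lipschitz onto its image: its
  linear left inverse is also bounded. Hence it distorts distances by at most constant factors.
\<close>

text \<open>Expanding the argument in a finite orthogonal spanning set turns \<open>f\<close> into a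
  finite sum of fixed vectors weighted by bounded coefficient functionals. Staying in
  \<open>real_inner\<close> keeps the zero-dimensional space covered.\<close>

lemma fin_dim_linear_imp_bounded_linear:
  fixes f :: "'a::real_inner \<Rightarrow> 'b::real_normed_vector"
  assumes "fin_dim TYPE('a)" and f: "linear f"
  shows "bounded_linear f"
proof -
  obtain B :: "'a set" where B: "finite B" "span B = UNIV"
    using assms(1) unfolding fin_dim_def by blast
  then obtain C :: "'a set" where C: "finite C" "span C = UNIV" "pairwise orthogonal C"
    using basis_orthogonal[OF B(1)] by metis
  have expand: "(\<Sum>b\<in>C. ((x \<bullet> b) / (b \<bullet> b)) *\<^sub>R b) = x" for x
  proof -
    define d where "d = x - (\<Sum>b\<in>C. ((x \<bullet> b) / (b \<bullet> b)) *\<^sub>R b)"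
    have "orthogonal d c" if c: "c \<in> C" for c
    proof -
      have "(\<Sum>b\<in>C. ((x \<bullet> b) / (b \<bullet> b)) *\<^sub>R b) \<bullet> c
          = (\<Sum>b\<in>C. if b = c then x \<bullet> c else 0)"
        unfolding inner_sum_left
      proof (rule sum.cong)
        fix b assume b: "b \<in> C"
        \<comment> \<open>The set \<open>C\<close> may contain 0: for \<open>b = c = 0\<close> the
          quotient is 0 by convention and both sides vanish.\<close>
        show "(((x \<bullet> b) / (b \<bullet> b)) *\<^sub>R b) \<bullet> c = (if b = c then x \<bullet> c else 0)"
          using C(3) b c by (cases "b = c") (auto simp: pairwise_def orthogonal_def)
      qed simp
      also have "\<dots> = x \<bullet> c"
        using C(1) c by simp
      finally show ?thesis
        by (simp add: d_def orthogonal_def inner_diff_left)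
    qed
    \<comment> \<open>The remainder \<open>d\<close> is orthogonal to \<open>C\<close>, hence to
      \<open>span C = UNIV\<close>, which contains \<open>d\<close> itself.\<close>
    then have "orthogonal d d"
      using orthogonal_to_span[of d C d] C(2) by (simp add: orthogonal_commute)
    then show ?thesis
      by (simp add: d_def orthogonal_self)
  qed
  have "bounded_linear (\<lambda>x. \<Sum>b\<in>C. ((x \<bullet> b) / (b \<bullet> b)) *\<^sub>R f b)"
    by (intro bounded_linear_sum bounded_linear_scaleR_const
        bounded_linear_compose[OF bounded_linear_divide] bounded_linear_inner_left)
  moreover have "(\<lambda>x. \<Sum>b\<in>C. ((x \<bullet> b) / (b \<bullet> b)) *\<^sub>R f b) = f"
  proof
    fix x
    have "f x = f (\<Sum>b\<in>C. ((x \<bullet> b) / (b \<bullet> b)) *\<^sub>R b)"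
      by (simp only: expand)
    then show "(\<Sum>b\<in>C. ((x \<bullet> b) / (b \<bullet> b)) *\<^sub>R f b) = f x"
      by (simp add: linear_sum[OF f] linear_scale[OF f])
  qed
  ultimately show ?thesis
    by simp
qed

text \<open>Nonemptiness matters, since \<open>infdist x {}\<close> is 0 by convention.\<close>

lemma infdist_greatest:
  assumes "S \<noteq> {}" "\<And>y. y \<in> S \<Longrightarrow> c \<le> dist x y"
  shows "c \<le> infdist x S"
  using assms by (simp add: infdist_notempty cINF_greatest)

text \<open>Applied to the two projections with \<open>B = 1\<close>, and to an injective linear map
  and its left inverse. Dividing by \<open>B\<close> makes the claim a lower bound for all
  \<open>dist x y\<close>.\<close>

lemma infdist_image_le:
  assumes "S \<noteq> {}" "0 < B" "\<And>u v. dist (h u) (h v) \<le> B * dist u v"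
  shows "infdist (h x) (h ` S) \<le> B * infdist x S"
proof -
  have "infdist (h x) (h ` S) / B \<le> infdist x S"
  proof (rule infdist_greatest[OF assms(1)])
    fix y assume "y \<in> S"
    then have "infdist (h x) (h ` S) \<le> B * dist x y"
      using assms(3) by (intro infdist_le2[of "h y"]) auto
    then show "infdist (h x) (h ` S) / B \<le> dist x y"
      using assms(2) by (simp add: field_simps)
  qed
  then show ?thesis
    using assms(2) by (simp add: field_simps)
qed

text \<open>The product norm is at most the sum of the component norms. The subtractions allow the
  infimum to be taken over \<open>t\<close> first, with \<open>s\<close> fixed, and then over
  \<open>s\<close>.\<close>

lemma infdist_Times_le:
  assumes "S \<noteq> {}" "T \<noteq> {}"
  shows "infdist (x, y) (S \<times> T) \<le> infdist x S + infdist y T"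
proof -
  have "infdist (x, y) (S \<times> T) - infdist y T \<le> infdist x S"
  proof (rule infdist_greatest[OF assms(1)])
    fix s assume s: "s \<in> S"
    have "infdist (x, y) (S \<times> T) - dist x s \<le> infdist y T"
    proof (rule infdist_greatest[OF assms(2)])
      fix t assume t: "t \<in> T"
      have "infdist (x, y) (S \<times> T) \<le> dist (x, y) (s, t)"
        using s t by (intro infdist_le) auto
      also have "\<dots> \<le> dist x s + dist y t"
        unfolding dist_Pair_Pair by (rule sqrt_sum_squares_le_sum) auto
      finally show "infdist (x, y) (S \<times> T) - dist x s \<le> dist y t"
        by simp
    qed
    then show "infdist (x, y) (S \<times> T) - infdist y T \<le> dist x s"
      by simp
  qed
  then show ?thesis
    by simp
qed

lemma amenable_face:
  assumes "amenable K" "cone_face F K"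
  obtains \<kappa> where "\<kappa> > 0" "\<And>x. x \<in> span F \<Longrightarrow> infdist x F \<le> \<kappa> * infdist x K"
  using assms unfolding amenable_def by blast

lemma cone_face_Times:
  fixes F :: "('a::real_vector \<times> 'b::real_vector) set"
  assumes F: "cone_face F (K1 \<times> K2)" and K: "convex_cone K1" "convex_cone K2"
  shows "cone_face (fst ` F) K1" "cone_face (snd ` F) K2" "F = fst ` F \<times> snd ` F"
proof -
  have cc: "convex_cone F" and sub: "F \<subseteq> K1 \<times> K2"
    and face: "\<And>p q. p \<in> K1 \<times> K2 \<Longrightarrow> q \<in> K1 \<times> K2 \<Longrightarrow> p + q \<in> F \<Longrightarrow> p \<in> F \<and> q \<in> F"
    using F by (auto simp: cone_face_def)
  have zero: "0 \<in> K1" "0 \<in> K2"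
    using K by (auto intro: convex_cone_contains_0)
  have split: "(x, 0) \<in> F \<and> (0, y) \<in> F" if "(x, y) \<in> F" for x y
    using face[of "(x, 0)" "(0, y)"] that sub zero by auto
  \<comment> \<open>The projections of \<open>F\<close> agree with its slices along the axes, so the
    face condition of \<open>F\<close> can be tested on pairs with one zero component.\<close>
  have fstF: "x \<in> fst ` F \<longleftrightarrow> (x, 0) \<in> F" and sndF: "y \<in> snd ` F \<longleftrightarrow> (0, y) \<in> F" for x y
    using split by force+
  have "linear (fst :: 'a \<times> 'b \<Rightarrow> 'a)" "linear (snd :: 'a \<times> 'b \<Rightarrow> 'b)"
    by (auto simp: linear_fst linear_snd)
  then have conv: "convex_cone (fst ` F)" "convex_cone (snd ` F)"
    using cc by (auto intro: convex_cone_linear_image)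
  have "x \<in> fst ` F \<and> y \<in> fst ` F" if "x \<in> K1" "y \<in> K1" "x + y \<in> fst ` F" for x y
    using face[of "(x, 0)" "(y, 0)"] that zero unfolding fstF by auto
  then show "cone_face (fst ` F) K1"
    using conv sub unfolding cone_face_def by auto
  have "x \<in> snd ` F \<and> y \<in> snd ` F" if "x \<in> K2" "y \<in> K2" "x + y \<in> snd ` F" for x y
    using face[of "(0, x)" "(0, y)"] that zero unfolding sndF by auto
  then show "cone_face (snd ` F) K2"
    using conv sub unfolding cone_face_def by auto
  have "(x, y) \<in> F" if "x \<in> fst ` F" "y \<in> snd ` F" for x y
    using convex_cone_add[OF cc, of "(x, 0)" "(0, y)"] that unfolding fstF sndF by simp
  then show "F = fst ` F \<times> snd ` F"
    by force
qed

lemma amenable_Times: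
  fixes K1 :: "'a::real_inner set" and K2 :: "'b::real_inner set"
  assumes "amenable K1" "amenable K2"
  shows "amenable (K1 \<times> K2)"
  unfolding amenable_def
proof (intro conjI allI impI)
  have cl: "closed K1" "closed K2" and cc: "convex_cone K1" "convex_cone K2"
    using assms by (auto simp: amenable_def)
  show "closed (K1 \<times> K2)" "convex_cone (K1 \<times> K2)"
    using cl cc by (auto simp: closed_Times convex_cone_Times)
  have ne: "K1 \<times> K2 \<noteq> {}" "K1 \<noteq> {}" "K2 \<noteq> {}"
    using cc by (auto dest: convex_cone_nonempty)
  fix F assume F: "cone_face F (K1 \<times> K2)"
  define F1 where "F1 = fst ` F"
  define F2 where "F2 = snd ` F"
  have F1: "cone_face F1 K1" and F2: "cone_face F2 K2" and F_eq: "F = F1 \<times> F2"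
    using cone_face_Times[OF F cc] by (simp_all add: F1_def F2_def)
  have neF: "F1 \<noteq> {}" "F2 \<noteq> {}"
    using F1 F2 by (auto simp: cone_face_def dest: convex_cone_nonempty)
  obtain k1 where k1: "k1 > 0" "\<And>x. x \<in> span F1 \<Longrightarrow> infdist x F1 \<le> k1 * infdist x K1"
    using amenable_face[OF assms(1) F1] by blast
  obtain k2 where k2: "k2 > 0" "\<And>x. x \<in> span F2 \<Longrightarrow> infdist x F2 \<le> k2 * infdist x K2"
    using amenable_face[OF assms(2) F2] by blast
  show "\<exists>\<kappa>>0. \<forall>p\<in>span F. infdist p F \<le> \<kappa> * infdist p (K1 \<times> K2)"
  proof (intro exI conjI ballI)
    \<comment> \<open>Each component distance is at most \<open>k1\<close> resp. \<open>k2\<close>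
      times the distance to the product cone; the two bounds are added.\<close>
    show "k1 + k2 > 0"
      using k1 k2 by simp
    fix p assume p: "p \<in> span F"
    have "fst p \<in> span F1" "snd p \<in> span F2"
      unfolding F1_def F2_def
      using p linear_span_image[OF linear_fst, of F] linear_span_image[OF linear_snd, of F]
      by auto
    \<comment> \<open>\<open>fst\<close> is 1-Lipschitz and maps \<open>K1 \<times> K2\<close> onto
      \<open>K1\<close> because \<open>K2\<close> is nonempty.\<close>
    moreover have "infdist (fst p) K1 \<le> infdist p (K1 \<times> K2)"
      using infdist_image_le[OF ne(1), of 1 fst p] ne dist_fst_le by (auto simp: fst_image_times)
    moreover have "infdist (snd p) K2 \<le> infdist p (K1 \<times> K2)"
      using infdist_image_le[OF ne(1), of 1 snd p] ne dist_snd_le by (auto simp: snd_image_times)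
    ultimately have "infdist (fst p) F1 \<le> k1 * infdist p (K1 \<times> K2)"
      and "infdist (snd p) F2 \<le> k2 * infdist p (K1 \<times> K2)"
      using k1 k2 by (meson less_imp_le mult_left_mono order_trans)+
    moreover have "infdist p F \<le> infdist (fst p) F1 + infdist (snd p) F2"
      using infdist_Times_le[OF neF, of "fst p" "snd p"] by (simp add: F_eq)
    ultimately show "infdist p F \<le> (k1 + k2) * infdist p (K1 \<times> K2)"
      by (simp add: distrib_right)
  qed
qed

text \<open>Faces of the image pull back to faces of \<open>K\<close>: injectivity keeps the
  preimage inside \<open>K\<close> and lets the cone property be reflected through
  \<open>A\<close>.\<close>

lemma cone_face_vimage:
  assumes F: "cone_face F (A ` K)" and A: "linear A" "inj A"
  shows "cone_face (A -` F) K" "A ` (A -` F) = F"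
proof -
  have sub: "F \<subseteq> A ` K"
    using F by (simp add: cone_face_def)
  then show eq: "A ` (A -` F) = F"
    by blast
  have "convex_cone (A -` F)"
    using F convex_cone_linear_image_eq[OF A, of "A -` F"] unfolding eq cone_face_def by blast
  moreover have "A -` F \<subseteq> K"
    using sub A(2) by (auto dest: injD)
  moreover have "x \<in> A -` F \<and> y \<in> A -` F" if "x \<in> K" "y \<in> K" "x + y \<in> A -` F" for x y
    using F that linear_add[OF A(1), of x y] by (simp add: cone_face_def)
  ultimately show "cone_face (A -` F) K"
    by (auto simp: cone_face_def)
qed

lemma amenable_injective_linear_image:
  fixes K :: "'a::real_inner set" and A :: "'a \<Rightarrow> 'b::real_inner"
  assumes fin: "fin_dim TYPE('a)" "fin_dim TYPE('b)"
    and K: "amenable K" and A: "linear A" "inj A"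
  shows "amenable (A ` K)"
  unfolding amenable_def
proof (intro conjI allI impI)
  obtain g where g: "linear g" "g \<circ> A = id"
    using linear_injective_left_inverse[OF A] by blast
  have gA: "g (A x) = x" for x
    using g(2) by (metis comp_apply id_apply)
  \<comment> \<open>Finite dimension of the domain bounds \<open>A\<close>, that of the codomain
    bounds \<open>g\<close>.\<close>
  have bA: "bounded_linear A" and bg: "bounded_linear g"
    using fin A(1) g(1) by (auto intro: fin_dim_linear_imp_bounded_linear)
  obtain a where a: "a > 0" "\<And>x. norm (A x) \<le> norm x * a"
    using bounded_linear.pos_bounded[OF bA] by blast
  obtain c where c: "c > 0" "\<And>x. norm (g x) \<le> norm x * c"
    using bounded_linear.pos_bounded[OF bg] by blast
  have dA: "dist (A u) (A v) \<le> a * dist u v" for u v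
    using a(2)[of "u - v"] by (simp add: dist_norm linear_diff[OF A(1)] mult.commute)
  have dg: "dist (g u) (g v) \<le> c * dist u v" for u v
    using c(2)[of "u - v"] by (simp add: dist_norm linear_diff[OF g(1)] mult.commute)
  have clK: "closed K" and cc: "convex_cone K"
    using K by (auto simp: amenable_def)
  have contA: "continuous_on UNIV A" and contg: "continuous_on UNIV g"
    using bA bg by (auto intro: linear_continuous_on)
  \<comment> \<open>The equation \<open>A (g y) = y\<close> describes the range of \<open>A\<close>,
    so the image is an intersection of two closed sets.\<close>
  have "A ` K = {y. A (g y) = y} \<inter> g -` K"
    using gA by force
  moreover have "closed {y. A (g y) = y}"
    by (intro closed_Collect_eq continuous_on_compose2[OF contA contg] continuous_on_id) auto
  moreover have "closed (g -` K)"
    using clK contg by (rule closed_vimage)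
  ultimately show "closed (A ` K)"
    by auto
  show "convex_cone (A ` K)"
    using cc A(1) by (simp add: convex_cone_linear_image)
  fix F assume F: "cone_face F (A ` K)"
  define G where "G = A -` F"
  have G: "cone_face G K" and AG: "A ` G = F"
    using cone_face_vimage[OF F A] by (simp_all add: G_def)
  have neG: "G \<noteq> {}" and neK: "A ` K \<noteq> {}"
    using G cc by (auto simp: cone_face_def dest: convex_cone_nonempty)
  obtain k where k: "k > 0" "\<And>x. x \<in> span G \<Longrightarrow> infdist x G \<le> k * infdist x K"
    using amenable_face[OF K G] by blast
  show "\<exists>\<kappa>>0. \<forall>x\<in>span F. infdist x F \<le> \<kappa> * infdist x (A ` K)"
  proof (intro exI conjI ballI)
    \<comment> \<open>The factors are the bound of \<open>A\<close>, the amenability constant of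
      \<open>K\<close> for the face \<open>G\<close>, and the bound of \<open>g\<close>.\<close>
    show "a * (k * c) > 0"
      using a(1) k(1) c(1) by simp
    fix x assume "x \<in> span F"
    then obtain u where u: "u \<in> span G" "x = A u"
      using linear_span_image[OF A(1), of G] by (auto simp: AG)
    have "infdist x F \<le> a * infdist u G"
      using infdist_image_le[OF neG a(1) dA] by (simp add: AG u(2))
    also have "\<dots> \<le> a * (k * infdist u K)"
      using k(2)[OF u(1)] a(1) by simp
    also have "infdist u K \<le> c * infdist x (A ` K)"
      using infdist_image_le[OF neK c(1) dg, of x] by (simp add: u(2) gA image_image)
    finally show "infdist x F \<le> a * (k * c) * infdist x (A ` K)"
      using a(1) k(1) by (simp add: mult.assoc)
  qed
qed

theorem proposition11:
  fixes K1 :: "'a::real_inner set" and K2 :: "'b::real_inner set"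
    and K :: "'c::real_inner set" and A :: "'c \<Rightarrow> 'd::real_inner"
  shows "(fin_dim TYPE('a) \<and> fin_dim TYPE('b) \<and>
          closed K1 \<and> convex_cone K1 \<and> pointed K1 \<and> amenable K1 \<and>
          closed K2 \<and> convex_cone K2 \<and> pointed K2 \<and> amenable K2
            \<longrightarrow> amenable (K1 \<times> K2)) \<and>
         (fin_dim TYPE('c) \<and> fin_dim TYPE('d) \<and>
          closed K \<and> convex_cone K \<and> pointed K \<and> amenable K \<and> linear A \<and> inj A
            \<longrightarrow> amenable (A ` K))"
  by (auto intro: amenable_Times amenable_injective_linear_image)

end
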